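(* Let $G=(V,E)$ be a finite simple graph and $A_G$ its adjacency matrix. Then $G$ simultaneously satisfies (i) $G$ is chordal (no induced cycle of length at least 4), (ii) $G$ has no induced claw $K_{1,3}$, and (iii) $G$ has no asteroidal triple, if and only if $A_G$ has no weighted asteroidal triple.
   Context: $A_G$ is the $V\times V$ symmetric $0/1$ matrix with $(A_G)_{uv}=1$ iff $\{u,v\}\in E$ for $u\ne v$. For a symmetric matrix $A$ indexed by $V$ and $z\in V$, a path avoiding $z$ in $A$ is a sequence $(v_0,\dots,v_m)$ ($m\ge0$) of distinct elements of $V\setminus\{z\}$ with $A_{v_{i-1}v_i}>\min\{A_{v_{i-1}z},A_{v_iz}\}$ for $1\le i\le m$; $x\overset{z}{\sim}y$ means such a path from $x$ to $y$ exists. A weighted asteroidal triple of $A$ is a set $\{x,y,z\}$ of three distinct elements with $x\overset{z}{\sim}y$, $y\overset{x}{\sim}z$, $z\overset{y}{\sim}x$. A path in $G$ from $x$ to $y$ misses $z$ if $z$ is adjacent to no vertex of the path. An asteroidal triple of $G$ is an independent set $\{x,y,z\}$ of three vertices such that between any two of them there is a path in $G$ missing the third. *)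

theory Defs
  imports Complex_Main
begin

text \<open>A graph is given by its vertex set \<open>V\<close> and its edge set \<open>E\<close>, a set of two-element
  subsets of \<open>V\<close>.\<close>

definition finite_simple_graph :: "'a set \<Rightarrow> 'a set set \<Rightarrow> bool" where
  "finite_simple_graph V E \<longleftrightarrow>
     finite V \<and> E \<subseteq> {{u, v} |u v. u \<in> V \<and> v \<in> V \<and> u \<noteq> v}"

definition graph_isomorphic ::
    "'a set \<Rightarrow> 'a set set \<Rightarrow> 'b set \<Rightarrow> 'b set set \<Rightarrow> bool" where
  "graph_isomorphic V E W F \<longleftrightarrow>
     (\<exists>f. bij_betw f V W \<and> (\<forall>u\<in>V. \<forall>v\<in>V. {u, v} \<in> E \<longleftrightarrow> {f u, f v} \<in> F))"

definition induced_edges :: "'a set set \<Rightarrow> 'a set \<Rightarrow> 'a set set" where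
  "induced_edges E S = {e \<in> E. e \<subseteq> S}"

definition has_induced ::
    "'a set \<Rightarrow> 'a set set \<Rightarrow> 'b set \<Rightarrow> 'b set set \<Rightarrow> bool" where
  "has_induced V E W F \<longleftrightarrow> (\<exists>S\<subseteq>V. graph_isomorphic S (induced_edges E S) W F)"

text \<open>Edges of the cycle on the vertices \<open>0, \<dots>, n - 1\<close>; this is a simple graph for \<open>n \<ge> 3\<close>.\<close>

definition cycle_edges :: "nat \<Rightarrow> nat set set" where
  "cycle_edges n = {{i, (i + 1) mod n} |i. i < n}"

definition chordal :: "'a set \<Rightarrow> 'a set set \<Rightarrow> bool" where
  "chordal V E \<longleftrightarrow> (\<forall>n\<ge>4. \<not> has_induced V E {..<n} (cycle_edges n))"

definition claw_free :: "'a set \<Rightarrow> 'a set set \<Rightarrow> bool" where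
  "claw_free V E \<longleftrightarrow>
     \<not> has_induced V E {0, 1, 2, 3 :: nat} {{0, 1}, {0, 2}, {0, 3}}"

definition graph_path ::
    "'a set \<Rightarrow> 'a set set \<Rightarrow> 'a \<Rightarrow> 'a \<Rightarrow> 'a list \<Rightarrow> bool" where
  "graph_path V E x y p \<longleftrightarrow>
     p \<noteq> [] \<and> hd p = x \<and> last p = y \<and> distinct p \<and> set p \<subseteq> V \<and>
     (\<forall>i. Suc i < length p \<longrightarrow> {p ! i, p ! Suc i} \<in> E)"

definition misses :: "'a set set \<Rightarrow> 'a list \<Rightarrow> 'a \<Rightarrow> bool" where
  "misses E p z \<longleftrightarrow> (\<forall>v\<in>set p. {z, v} \<notin> E)"

text \<open>Since \<open>T\<close> has three elements, \<open>T = {x, y, z}\<close> below ranges over the enumerations of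
  \<open>T\<close> by pairwise distinct \<open>x\<close>, \<open>y\<close>, \<open>z\<close>.\<close>

definition asteroidal_triple :: "'a set \<Rightarrow> 'a set set \<Rightarrow> 'a set \<Rightarrow> bool" where
  "asteroidal_triple V E T \<longleftrightarrow>
     T \<subseteq> V \<and> card T = 3 \<and> (\<forall>u\<in>T. \<forall>v\<in>T. {u, v} \<notin> E) \<and>
     (\<forall>x y z. T = {x, y, z} \<longrightarrow> (\<exists>p. graph_path V E x y p \<and> misses E p z))"

text \<open>A matrix indexed by \<open>V\<close> is a function of two arguments, of which only the values on
  \<open>V \<times> V\<close> are used. The diagonal of the adjacency matrix is zero, as \<open>E\<close> contains no
  singletons; diagonal entries play no role in the notions below.\<close>

definition adj_matrix :: "'a set set \<Rightarrow> 'a \<Rightarrow> 'a \<Rightarrow> real" where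
  "adj_matrix E u v = (if {u, v} \<in> E then 1 else 0)"

definition path_avoiding ::
    "'a set \<Rightarrow> ('a \<Rightarrow> 'a \<Rightarrow> real) \<Rightarrow> 'a \<Rightarrow> 'a list \<Rightarrow> bool" where
  "path_avoiding V A z p \<longleftrightarrow>
     p \<noteq> [] \<and> distinct p \<and> set p \<subseteq> V - {z} \<and>
     (\<forall>i. Suc i < length p \<longrightarrow>
        A (p ! i) (p ! Suc i) > min (A (p ! i) z) (A (p ! Suc i) z))"

definition conn_avoiding ::
    "'a set \<Rightarrow> ('a \<Rightarrow> 'a \<Rightarrow> real) \<Rightarrow> 'a \<Rightarrow> 'a \<Rightarrow> 'a \<Rightarrow> bool" where
  "conn_avoiding V A z x y \<longleftrightarrow> (\<exists>p. path_avoiding V A z p \<and> hd p = x \<and> last p = y)"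

text \<open>Intended for symmetric \<open>A\<close>, where \<open>conn_avoiding V A z\<close> is symmetric and the choice of
  the enumeration \<open>x\<close>, \<open>y\<close>, \<open>z\<close> of \<open>T\<close> is immaterial.\<close>

definition weighted_asteroidal_triple ::
    "'a set \<Rightarrow> ('a \<Rightarrow> 'a \<Rightarrow> real) \<Rightarrow> 'a set \<Rightarrow> bool" where
  "weighted_asteroidal_triple V A T \<longleftrightarrow>
     (\<exists>x y z. T = {x, y, z} \<and> T \<subseteq> V \<and> x \<noteq> y \<and> y \<noteq> z \<and> x \<noteq> z \<and>
        conn_avoiding V A z x y \<and> conn_avoiding V A x y z \<and> conn_avoiding V A y z x)"

end

theory Submission
  imports Defs
begin

text \<open>A vertex \<open>w\<close> adjacent to \<open>z\<close> on a path avoiding \<open>z\<close> has both path neighbours outside the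
  neighbourhood of \<open>z\<close>, so in a claw-free graph these are adjacent and \<open>w\<close> can be bypassed. Hence a
  weighted asteroidal triple that is independent is an asteroidal triple. If the triple spans
  one or two edges, the bypassed paths connect, for one of its edges \<open>xy\<close>, a private neighbour of \<open>x\<close> to
  a private neighbour of \<open>y\<close> without meeting a common neighbour of the two, and a shortest such
  connection closes up to an induced cycle. If it spans a triangle, the same observation
  produces for each edge a common neighbour not adjacent to the third vertex; these three
  neighbours form an asteroidal triple, or two of them lie on an induced 4-cycle.\<close>

section \<open>Induced subgraphs as embeddings of the pattern\<close>

text \<open>The inverse of an isomorphism onto the pattern embeds the pattern into \<open>V\<close>.
  In this form the vertices of an induced cycle or claw are directly available as
  \<open>g i\<close>.\<close>

lemma has_induced_iff_embedding:
  "has_induced V E W F \<longleftrightarrow>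
     (\<exists>g. inj_on g W \<and> g ` W \<subseteq> V \<and> (\<forall>i\<in>W. \<forall>j\<in>W. {g i, g j} \<in> E \<longleftrightarrow> {i, j} \<in> F))"
proof
  assume "has_induced V E W F"
  then obtain S f where S: "S \<subseteq> V" and f: "bij_betw f S W"
    and e: "\<And>u v. u \<in> S \<Longrightarrow> v \<in> S \<Longrightarrow> {u, v} \<in> induced_edges E S \<longleftrightarrow> {f u, f v} \<in> F"
    unfolding has_induced_def graph_isomorphic_def by blast
  define g where "g = inv_into S f"
  have g: "bij_betw g W S" and fg: "\<And>i. i \<in> W \<Longrightarrow> f (g i) = i"
    using f by (auto simp: g_def bij_betw_inv_into bij_betw_inv_into_right)
  have mem: "g i \<in> S" if "i \<in> W" for i
    using g that by (auto simp: bij_betw_def)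
  have "{g i, g j} \<in> E \<longleftrightarrow> {i, j} \<in> F" if "i \<in> W" "j \<in> W" for i j
    using e[of "g i" "g j"] mem that by (auto simp: fg induced_edges_def)
  then show "\<exists>g. inj_on g W \<and> g ` W \<subseteq> V \<and> (\<forall>i\<in>W. \<forall>j\<in>W. {g i, g j} \<in> E \<longleftrightarrow> {i, j} \<in> F)"
    using g S by (intro exI[of _ g]) (auto simp: bij_betw_def)
next
  assume "\<exists>g. inj_on g W \<and> g ` W \<subseteq> V \<and> (\<forall>i\<in>W. \<forall>j\<in>W. {g i, g j} \<in> E \<longleftrightarrow> {i, j} \<in> F)"
  then obtain g where inj: "inj_on g W" and sub: "g ` W \<subseteq> V"
    and e: "\<forall>i\<in>W. \<forall>j\<in>W. {g i, g j} \<in> E \<longleftrightarrow> {i, j} \<in> F"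
    by (elim exE conjE) (rule that)
  have "bij_betw (inv_into W g) (g ` W) W"
    using inj by (intro bij_betw_inv_into) (simp add: bij_betw_def)
  moreover have "{u, v} \<in> induced_edges E (g ` W) \<longleftrightarrow> {inv_into W g u, inv_into W g v} \<in> F"
    if "u \<in> g ` W" "v \<in> g ` W" for u v
    using that e inj by (auto simp: induced_edges_def)
  ultimately show "has_induced V E W F"
    unfolding has_induced_def graph_isomorphic_def using sub by blast
qed

lemma cycle_edges_iff:
  assumes "n \<ge> 3" "i < n" "j < n"
  shows "{i, j} \<in> cycle_edges n \<longleftrightarrow>
    j = Suc i \<or> i = Suc j \<or> (i = 0 \<and> j = n - 1) \<or> (j = 0 \<and> i = n - 1)"
proof -
  have 1: "{i, j} \<in> cycle_edges n \<longleftrightarrow> j = Suc i mod n \<or> i = Suc j mod n"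
    using assms by (auto simp: cycle_edges_def doubleton_eq_iff)
  have 2: "Suc k mod n = (if k = n - 1 then 0 else Suc k)" if "k < n" for k
    using that by auto
  show ?thesis
    unfolding 1 2[OF assms(2)] 2[OF assms(3)] using assms by auto
qed

text \<open>Adjacency is symmetric and loop-free, so it is enough to compare pairs
  \<open>i < j\<close>; on these the cycle has only successor edges and the closing edge from
  \<open>0\<close> to \<open>n - 1\<close>.\<close>

lemma chordal_iff:
  assumes "finite_simple_graph V E"
  shows "chordal V E \<longleftrightarrow>
    (\<nexists>n g. n \<ge> 4 \<and> inj_on g {..<n} \<and> g ` {..<n} \<subseteq> V \<and>
       (\<forall>j<n. \<forall>i<j. {g i, g j} \<in> E \<longleftrightarrow> j = Suc i \<or> i = 0 \<and> j = n - 1))"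
proof -
  have loop: "{v} \<notin> E" for v
    using assms by (auto simp: finite_simple_graph_def)
  have "(\<forall>i<n. \<forall>j<n. {g i, g j} \<in> E \<longleftrightarrow> {i, j} \<in> cycle_edges n) \<longleftrightarrow>
      (\<forall>j<n. \<forall>i<j. {g i, g j} \<in> E \<longleftrightarrow> j = Suc i \<or> i = 0 \<and> j = n - 1)" (is "?L \<longleftrightarrow> ?R")
    if "n \<ge> 4" for n and g :: "nat \<Rightarrow> 'a"
  proof
    assume ?L
    then show ?R
      using that by (auto simp: cycle_edges_iff)
  next
    assume R: ?R
    show ?L
    proof (intro allI impI)
      fix i j assume "i < n" "j < n"
      then consider "i < j" | "i = j" | "j < i" by linarith
      then show "{g i, g j} \<in> E \<longleftrightarrow> {i, j} \<in> cycle_edges n"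
      proof cases
        case 1
        then show ?thesis
          using R that \<open>j < n\<close> by (auto simp: cycle_edges_iff)
      next
        case 2
        then show ?thesis
          using loop that \<open>j < n\<close> cycle_edges_iff[of n j j] by auto
      next
        case 3
        then have "{g j, g i} \<in> E \<longleftrightarrow> {j, i} \<in> cycle_edges n"
          using R that \<open>i < n\<close> by (auto simp: cycle_edges_iff)
        then show ?thesis
          by (simp add: insert_commute)
      qed
    qed
  qed
  then show ?thesis
    unfolding chordal_def has_induced_iff_embedding by (simp add: Ball_def)
qed

text \<open>Edges have two distinct ends in \<open>V\<close>, which yields membership of all four
  vertices and separates the centre \<open>c\<close> from the leaves.\<close>

lemma claw_free_iff:
  assumes "finite_simple_graph V E"
  shows "claw_free V E \<longleftrightarrow>
    (\<nexists>c a b d. {c, a} \<in> E \<and> {c, b} \<in> E \<and> {c, d} \<in> E \<and> a \<noteq> b \<and> a \<noteq> d \<and> b \<noteq> d \<and>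
       {a, b} \<notin> E \<and> {a, d} \<notin> E \<and> {b, d} \<notin> E)"
proof -
  have loop: "{v} \<notin> E" for v
    using assms by (auto simp: finite_simple_graph_def)
  have inV: "u \<in> V \<and> v \<in> V" if "{u, v} \<in> E" for u v
    using assms that by (fastforce simp: finite_simple_graph_def doubleton_eq_iff)
  let ?W = "{0, 1, 2, 3 :: nat}" and ?F = "{{0, 1}, {0, 2}, {0, 3 :: nat}}"
  have "has_induced V E ?W ?F \<longleftrightarrow>
    (\<exists>c a b d. {c, a} \<in> E \<and> {c, b} \<in> E \<and> {c, d} \<in> E \<and> a \<noteq> b \<and> a \<noteq> d \<and> b \<noteq> d \<and>
       {a, b} \<notin> E \<and> {a, d} \<notin> E \<and> {b, d} \<notin> E)" (is "_ \<longleftrightarrow> ?R")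
  proof
    assume "has_induced V E ?W ?F"
    then obtain g where g: "inj_on g ?W"
      and e: "\<forall>i\<in>?W. \<forall>j\<in>?W. {g i, g j} \<in> E \<longleftrightarrow> {i, j} \<in> ?F"
      unfolding has_induced_iff_embedding by (elim exE conjE) (rule that)
    have "{g 0, g 1} \<in> E" "{g 0, g 2} \<in> E" "{g 0, g 3} \<in> E"
      "{g 1, g 2} \<notin> E" "{g 1, g 3} \<notin> E" "{g 2, g 3} \<notin> E"
      using e by (simp_all add: doubleton_eq_iff del: One_nat_def)
    moreover have "g 1 \<noteq> g 2" "g 1 \<noteq> g 3" "g 2 \<noteq> g 3"
      using g by (simp_all add: inj_on_def)
    ultimately show ?R
      by (intro exI[of _ "g 0"] exI[of _ "g 1"] exI[of _ "g 2"] exI[of _ "g 3"] conjI)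
  next
    assume ?R
    then obtain c a b d where E: "{c, a} \<in> E" "{c, b} \<in> E" "{c, d} \<in> E"
      and ne: "a \<noteq> b" "a \<noteq> d" "b \<noteq> d"
      and nE: "{a, b} \<notin> E" "{a, d} \<notin> E" "{b, d} \<notin> E"
      by (elim exE conjE) (rule that)
    define g :: "nat \<Rightarrow> 'a" where "g i = [c, a, b, d] ! i" for i
    have g: "g 0 = c" "g 1 = a" "g 2 = b" "g 3 = d"
      by (simp_all add: g_def numeral_3_eq_3)
    have "c \<noteq> a" "c \<noteq> b" "c \<noteq> d"
      using E loop by auto
    then have "inj_on g ?W" "g ` ?W \<subseteq> V"
      using ne inV E g by auto
    moreover have "\<forall>i\<in>?W. \<forall>j\<in>?W. {g i, g j} \<in> E \<longleftrightarrow> {i, j} \<in> ?F"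
      using E nE loop by (simp add: g insert_commute doubleton_eq_iff del: One_nat_def)
    ultimately show "has_induced V E ?W ?F"
      unfolding has_induced_iff_embedding by (intro exI[of _ g] conjI)
  qed
  then show ?thesis
    unfolding claw_free_def by (rule arg_cong[of _ _ Not])
qed

section \<open>Avoiding and missing paths as reachability\<close>

text \<open>If the vertex to be prepended already lies on the path, the suffix starting there is
  used instead. The bound on \<open>set p\<close> lets invariants of reachability pass to every
  vertex of the path.\<close>

lemma rtranclp_imp_distinct_path:
  assumes "r\<^sup>*\<^sup>* x y"
  shows "\<exists>p. p \<noteq> [] \<and> hd p = x \<and> last p = y \<and> distinct p \<and> set p \<subseteq> {v. r\<^sup>*\<^sup>* x v} \<and>
    (\<forall>i. Suc i < length p \<longrightarrow> r (p ! i) (p ! Suc i))"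
  using assms
proof (induction rule: converse_rtranclp_induct)
  case base
  then show ?case
    by (intro exI[of _ "[y]"]) auto
next
  case (step x x')
  then obtain p where p: "p \<noteq> []" "hd p = x'" "last p = y" "distinct p"
    "set p \<subseteq> {v. r\<^sup>*\<^sup>* x' v}" "\<forall>i. Suc i < length p \<longrightarrow> r (p ! i) (p ! Suc i)"
    by blast
  have sub: "set p \<subseteq> {v. r\<^sup>*\<^sup>* x v}"
    using p(5) \<open>r x x'\<close> by (auto intro: converse_rtranclp_into_rtranclp)
  show ?case
  proof (cases "x \<in> set p")
    case True
    then obtain us vs where uv: "p = us @ x # vs"
      by (meson split_list)
    have "r ((x # vs) ! i) ((x # vs) ! Suc i)" if "Suc i < length (x # vs)" for i
      using p(6)[rule_format, of "length us + i"] that by (simp add: uv nth_append)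
    then show ?thesis
      using p sub uv by (intro exI[of _ "x # vs"]) auto
  next
    case False
    have "r ((x # p) ! i) ((x # p) ! Suc i)" if "Suc i < length (x # p)" for i
      using that p \<open>r x x'\<close> by (cases i) (auto simp: hd_conv_nth)
    then show ?thesis
      using p sub False by (intro exI[of _ "x # p"]) auto
  qed
qed

lemma path_imp_rtranclp:
  assumes "p \<noteq> []" "\<forall>i. Suc i < length p \<longrightarrow> r (p ! i) (p ! Suc i)"
  shows "r\<^sup>*\<^sup>* (hd p) (last p)"
proof -
  have "r\<^sup>*\<^sup>* (p ! 0) (p ! i)" if "i < length p" for i
    using that assms(2) by (induction i) (auto intro: rtranclp.rtrancl_into_rtrancl)
  then show ?thesis
    using assms(1) by (simp add: hd_conv_nth last_conv_nth)
qed

text \<open>One step of a path avoiding \<open>z\<close> in the adjacency matrix: with 0/1 entries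
  the strict inequality holds iff the left side is 1 and one of the two entries on the right is
  0.\<close>

definition avoid_step :: "'a set set \<Rightarrow> 'a \<Rightarrow> 'a \<Rightarrow> 'a \<Rightarrow> bool" where
  "avoid_step E z u v \<longleftrightarrow>
     {u, v} \<in> E \<and> u \<noteq> z \<and> v \<noteq> z \<and> ({u, z} \<notin> E \<or> {v, z} \<notin> E)"

text \<open>One step of a path missing \<open>z\<close>: compared with \<open>avoid_step\<close>,
  both ends instead of at least one lie outside the neighbourhood of \<open>z\<close>.\<close>

definition miss_step :: "'a set set \<Rightarrow> 'a \<Rightarrow> 'a \<Rightarrow> 'a \<Rightarrow> bool" where
  "miss_step E z u v \<longleftrightarrow>
     {u, v} \<in> E \<and> u \<noteq> z \<and> v \<noteq> z \<and> {u, z} \<notin> E \<and> {v, z} \<notin> E"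

lemma miss_step_rtranclp_sym: "(miss_step E z)\<^sup>*\<^sup>* x y \<Longrightarrow> (miss_step E z)\<^sup>*\<^sup>* y x"
  by (rule sympD[OF symp_rtranclp]) (auto simp: symp_def miss_step_def insert_commute)

lemma min_adj_matrix_less_iff:
  "min (adj_matrix E u z) (adj_matrix E v z) < adj_matrix E u v \<longleftrightarrow>
     {u, v} \<in> E \<and> ({u, z} \<notin> E \<or> {v, z} \<notin> E)"
  by (auto simp: adj_matrix_def)

lemma rtranclp_in_vertices:
  assumes "finite_simple_graph V E" "\<And>u v. r u v \<Longrightarrow> {u, v} \<in> E" "r\<^sup>*\<^sup>* x v" "x \<in> V"
  shows "v \<in> V"
  using assms(3,4)
proof (induction rule: rtranclp_induct)
  case (step u v)
  then have "{u, v} \<in> E" using assms(2) by blast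
  then show ?case
    using assms(1) by (fastforce simp: finite_simple_graph_def doubleton_eq_iff)
qed

text \<open>The assumptions on \<open>x\<close> cover the one-vertex path, about which the reflexive
  closure says nothing; along steps, membership in \<open>V\<close> and distinctness from
  \<open>z\<close> persist.\<close>

lemma conn_avoiding_adj_matrix_iff:
  assumes G: "finite_simple_graph V E" and x: "x \<in> V" "x \<noteq> z"
  shows "conn_avoiding V (adj_matrix E) z x y \<longleftrightarrow> (avoid_step E z)\<^sup>*\<^sup>* x y"
proof
  assume "conn_avoiding V (adj_matrix E) z x y"
  then obtain p where p: "path_avoiding V (adj_matrix E) z p" "hd p = x" "last p = y"
    unfolding conn_avoiding_def by blast
  then have ne: "p \<noteq> []" and sub: "set p \<subseteq> V - {z}"
    and step: "\<And>i. Suc i < length p \<Longrightarrow> {p ! i, p ! Suc i} \<in> E \<and>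
      ({p ! i, z} \<notin> E \<or> {p ! Suc i, z} \<notin> E)"
    unfolding path_avoiding_def min_adj_matrix_less_iff by blast+
  have "avoid_step E z (p ! i) (p ! Suc i)" if "Suc i < length p" for i
  proof -
    have "p ! i \<in> set p" "p ! Suc i \<in> set p"
      using that by simp_all
    then show ?thesis
      unfolding avoid_step_def using sub step[OF that] by blast
  qed
  then show "(avoid_step E z)\<^sup>*\<^sup>* x y"
    using path_imp_rtranclp[of p "avoid_step E z"] ne p by simp
next
  assume "(avoid_step E z)\<^sup>*\<^sup>* x y"
  then obtain p where p: "p \<noteq> []" "hd p = x" "last p = y" "distinct p"
    "set p \<subseteq> {v. (avoid_step E z)\<^sup>*\<^sup>* x v}"
    and step: "\<forall>i. Suc i < length p \<longrightarrow> avoid_step E z (p ! i) (p ! Suc i)"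
    using rtranclp_imp_distinct_path[of "avoid_step E z" x y] by blast
  have "v \<in> V - {z}" if "(avoid_step E z)\<^sup>*\<^sup>* x v" for v
  proof -
    have "v \<in> V"
      by (rule rtranclp_in_vertices[OF G _ that x(1)]) (simp add: avoid_step_def)
    moreover have "v \<noteq> z"
      using that x(2) by (induction rule: rtranclp_induct) (auto simp: avoid_step_def)
    ultimately show ?thesis by simp
  qed
  then have "path_avoiding V (adj_matrix E) z p"
    unfolding path_avoiding_def min_adj_matrix_less_iff
    using p step by (auto simp: avoid_step_def)
  then show "conn_avoiding V (adj_matrix E) z x y"
    unfolding conn_avoiding_def using p by blast
qed

lemma weighted_asteroidal_triple_adj_matrix_iff:
  assumes "finite_simple_graph V E"
  shows "weighted_asteroidal_triple V (adj_matrix E) T \<longleftrightarrow>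
    (\<exists>x y z. T = {x, y, z} \<and> T \<subseteq> V \<and> x \<noteq> y \<and> y \<noteq> z \<and> x \<noteq> z \<and>
       (avoid_step E z)\<^sup>*\<^sup>* x y \<and> (avoid_step E x)\<^sup>*\<^sup>* y z \<and> (avoid_step E y)\<^sup>*\<^sup>* z x)"
proof -
  have "conn_avoiding V (adj_matrix E) z x y \<longleftrightarrow> (avoid_step E z)\<^sup>*\<^sup>* x y"
    if "{x, y, z} \<subseteq> V" "x \<noteq> z" for x y z
    using conn_avoiding_adj_matrix_iff[OF assms] that by simp
  then show ?thesis
    unfolding weighted_asteroidal_triple_def by (intro ex_cong1) auto
qed

lemma asteroidal_tripleI:
  assumes G: "finite_simple_graph V E" and V: "x \<in> V" "y \<in> V" "z \<in> V"
    and ne: "x \<noteq> y" "y \<noteq> z" "x \<noteq> z"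
    and ind: "{x, y} \<notin> E" "{y, z} \<notin> E" "{z, x} \<notin> E"
    and conn: "(miss_step E z)\<^sup>*\<^sup>* x y" "(miss_step E x)\<^sup>*\<^sup>* y z" "(miss_step E y)\<^sup>*\<^sup>* z x"
  shows "asteroidal_triple V E {x, y, z}"
proof -
  have loop: "{v} \<notin> E" for v
    using G by (auto simp: finite_simple_graph_def)
  have path: "\<exists>p. graph_path V E u v p \<and> misses E p w"
    if conn: "(miss_step E w)\<^sup>*\<^sup>* u v" and "u \<in> V" "{w, u} \<notin> E" for u v w
  proof -
    obtain p where p: "p \<noteq> []" "hd p = u" "last p = v" "distinct p"
      "set p \<subseteq> {s. (miss_step E w)\<^sup>*\<^sup>* u s}"
      and step: "\<forall>i. Suc i < length p \<longrightarrow> miss_step E w (p ! i) (p ! Suc i)"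
      using rtranclp_imp_distinct_path[OF conn] by blast
    have "s \<in> V \<and> {w, s} \<notin> E" if "s \<in> set p" for s
    proof -
      have s: "(miss_step E w)\<^sup>*\<^sup>* u s" using p that by blast
      have "s \<in> V"
        by (rule rtranclp_in_vertices[OF G _ s \<open>u \<in> V\<close>]) (simp add: miss_step_def)
      moreover have "{w, s} \<notin> E"
        using s \<open>{w, u} \<notin> E\<close>
        by (induction rule: rtranclp_induct) (auto simp: miss_step_def insert_commute)
      ultimately show ?thesis by simp
    qed
    then have "graph_path V E u v p" "misses E p w"
      using p step by (auto simp: graph_path_def misses_def miss_step_def)
    then show ?thesis by blast
  qed
  have "\<exists>p. graph_path V E a b p \<and> misses E p c" if "{x, y, z} = {a, b, c}" for a b c
  proof -
    have "card {a, b, c} = 3"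
      using ne that[symmetric] by simp
    then have "a \<noteq> b" "b \<noteq> c" "a \<noteq> c"
      by (auto simp: card_insert_if split: if_splits)
    moreover have "a \<in> {x, y, z}" "b \<in> {x, y, z}" "c \<in> {x, y, z}"
      using that by simp_all
    \<comment> \<open>The definition asks for all six enumerations of the triple; symmetry of
      \<open>miss_step\<close> reduces them to the three cyclic ones.\<close>
    ultimately have
      "(a, b, c) \<in> {(x, y, z), (y, z, x), (z, x, y), (y, x, z), (z, y, x), (x, z, y)}"
      by auto
    then have "(miss_step E c)\<^sup>*\<^sup>* a b" "a \<in> V" "{c, a} \<notin> E"
      using conn conn[THEN miss_step_rtranclp_sym] V ind by (auto simp: insert_commute)
    then show ?thesis
      by (rule path)
  qed
  then show ?thesis
    unfolding asteroidal_triple_def using V ne ind loop by (auto simp: insert_commute)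
qed

section \<open>Bypassing neighbours, and private neighbours of an edge\<close>

text \<open>The witness \<open>y'\<close> is the last vertex outside the neighbourhood of
  \<open>z\<close> on the bypassed path: \<open>y\<close> itself, or a neighbour of \<open>y\<close>
  if \<open>y\<close> is adjacent to \<open>z\<close>. This invariant is carried along the
  path.\<close>

lemma bypass_neighbours:
  assumes G: "finite_simple_graph V E" and claw: "claw_free V E"
    and conn: "(avoid_step E z)\<^sup>*\<^sup>* x y" and x: "{x, z} \<notin> E" "x \<noteq> z"
  shows "\<exists>y'. (miss_step E z)\<^sup>*\<^sup>* x y' \<and> {y', z} \<notin> E \<and> y' \<noteq> z \<and>
    (if {y, z} \<in> E then {y', y} \<in> E else y' = y)"
  using conn
proof (induction rule: rtranclp_induct)
  case base
  then show ?case using x by auto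
next
  case (step y v)
  then obtain y' where y': "(miss_step E z)\<^sup>*\<^sup>* x y'" "{y', z} \<notin> E" "y' \<noteq> z"
    "if {y, z} \<in> E then {y', y} \<in> E else y' = y" by blast
  have yv: "{y, v} \<in> E" "v \<noteq> z" "{y, z} \<notin> E \<or> {v, z} \<notin> E"
    using step.hyps(2) by (auto simp: avoid_step_def)
  show ?case
  proof (cases "{v, z} \<in> E")
    case True
    \<comment> \<open>On entering the neighbourhood of \<open>z\<close>, the vertex \<open>y\<close>
      is still outside it, so \<open>y' = y\<close> also serves for \<open>v\<close>.\<close>
    then show ?thesis using y' yv by auto
  next
    case False
    have "y' = v \<or> {y', v} \<in> E"
    proof (rule ccontr)
      assume *: "\<not> ?thesis"
      then have "{y, z} \<in> E" "{y, y'} \<in> E" "{y, v} \<in> E"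
        using y' yv by (auto simp: insert_commute split: if_splits)
      \<comment> \<open>Otherwise \<open>y\<close> is the centre of a claw with leaves
        \<open>y'\<close>, \<open>v\<close> and \<open>z\<close>.\<close>
      with * False y' yv claw show False
        unfolding claw_free_iff[OF G] by blast
    qed
    then have "(miss_step E z)\<^sup>*\<^sup>* x v"
      using y' False yv(2) by (auto simp: miss_step_def intro: rtranclp.rtrancl_into_rtrancl)
    then show ?thesis using False yv by auto
  qed
qed

text \<open>The elements of a shortest connection between the private neighbourhoods of \<open>x\<close> and \<open>y\<close>,
  followed by \<open>x\<close> and \<open>y\<close>, form an induced cycle.\<close>

lemma chordal_private_neighbours_disconnected:
  assumes G: "finite_simple_graph V E" and ch: "chordal V E" and xy: "{x, y} \<in> E"
    and p: "{p, y} \<in> E" "{p, x} \<notin> E" "p \<noteq> x" and q: "{q, x} \<in> E" "{q, y} \<notin> E" "q \<noteq> y"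
    and conn: "(\<lambda>u v. {u, v} \<in> E \<and> v \<noteq> x \<and> v \<noteq> y \<and> \<not> ({v, x} \<in> E \<and> {v, y} \<in> E))\<^sup>*\<^sup>* p q"
  shows False
proof -
  \<comment> \<open>Only the target of a step is restricted; for the initial vertex the restrictions
    follow from membership in \<open>A\<close>.\<close>
  define r where
    "r u v \<longleftrightarrow> {u, v} \<in> E \<and> v \<noteq> x \<and> v \<noteq> y \<and> \<not> ({v, x} \<in> E \<and> {v, y} \<in> E)" for u v
  define A where "A = {v. {v, y} \<in> E \<and> {v, x} \<notin> E \<and> v \<noteq> x}"
  define B where "B = {v. {v, x} \<in> E \<and> {v, y} \<notin> E \<and> v \<noteq> y}"
  have loop: "{v} \<notin> E" for v
    using G by (auto simp: finite_simple_graph_def)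
  have inV: "u \<in> V \<and> v \<in> V" if "{u, v} \<in> E" for u v
    using G that by (fastforce simp: finite_simple_graph_def doubleton_eq_iff)
  have "x \<noteq> y" using xy loop by auto
  have "r\<^sup>*\<^sup>* p q" using conn by (simp add: r_def[abs_def])
  then obtain k where "(r ^^ k) p q"
    by (auto simp: rtranclp_power)
  moreover have "p \<in> A" "q \<in> B" using p q by (auto simp: A_def B_def)
  ultimately have ex: "\<exists>k. \<exists>a\<in>A. \<exists>b\<in>B. (r ^^ k) a b" by blast
  \<comment> \<open>The minimum is taken over all pairs of private neighbours, not just over
    connections from \<open>p\<close> to \<open>q\<close>, so that no other vertex of a shortest
    connection can be private.\<close>
  define m where "m = (LEAST k. \<exists>a\<in>A. \<exists>b\<in>B. (r ^^ k) a b)"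
  have least: "m \<le> k" if "(r ^^ k) a b" "a \<in> A" "b \<in> B" for k a b
    unfolding m_def using that by (intro Least_le) blast
  obtain a b where "a \<in> A" "b \<in> B" "(r ^^ m) a b"
    using LeastI_ex[OF ex] unfolding m_def by blast
  then obtain f where f0: "f 0 \<in> A" and fm: "f m \<in> B"
    and step: "\<And>i. i < m \<Longrightarrow> r (f i) (f (Suc i))"
    unfolding relpowp_fun_conv by blast
  have pow: "(r ^^ (j - i)) (f i) (f j)" if "i \<le> j" "j \<le> m" for i j
    unfolding relpowp_fun_conv using that step
    by (intro exI[of _ "\<lambda>k. f (i + k)"]) auto
  have "m \<noteq> 0"
    using f0 fm by (cases "m = 0") (auto simp: A_def B_def)
  have fne: "f i \<noteq> x" "f i \<noteq> y" "\<not> ({f i, x} \<in> E \<and> {f i, y} \<in> E)" if "i \<le> m" for i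
    using f0 loop step[of "i - 1"] that by (cases i; auto simp: A_def r_def)+
  have notA: "f i \<notin> A" if "i \<le> m" "i \<noteq> 0" for i
    using least[OF pow[of i m]] that fm \<open>m \<noteq> 0\<close> by fastforce
  have notB: "f i \<notin> B" if "i < m" for i
    using least[OF pow[of 0 i]] that f0 by fastforce
  \<comment> \<open>Common neighbours of \<open>x\<close> and \<open>y\<close> being excluded,
    adjacency to \<open>y\<close> amounts to membership in \<open>A\<close>, and adjacency to
    \<open>x\<close> to membership in \<open>B\<close>.\<close>
  have fy: "{f i, y} \<in> E \<longleftrightarrow> i = 0" if "i \<le> m" for i
    using notA[OF that] f0 fne[OF that] by (auto simp: A_def)
  have fx: "{f i, x} \<in> E \<longleftrightarrow> i = m" if "i \<le> m" for i
    using notB[of i] fm fne[OF that] that by (cases "i = m") (auto simp: B_def)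
  have neq: "f i \<noteq> f j" if "i < j" "j \<le> m" for i j
  proof
    assume "f i = f j"
    then have "(r ^^ (i + (m - j))) (f 0) (f m)"
      using pow[of 0 i] pow[of j m] that unfolding relpowp_add by auto
    from least[OF this f0 fm] show False using that by simp
  qed
  have fe: "{f i, f j} \<in> E \<longleftrightarrow> j = Suc i" if "i < j" "j \<le> m" for i j
  proof
    assume "{f i, f j} \<in> E"
    then have "r (f i) (f j)"
      using fne[OF that(2)] by (simp add: r_def)
    \<comment> \<open>The edge from \<open>f i\<close> to \<open>f j\<close> gives a connection of
      \<open>Suc i + (m - j)\<close> steps, which minimality allows only for
      \<open>j = Suc i\<close>.\<close>
    then have "(r ^^ Suc i) (f 0) (f j)"
      using pow[of 0 i] that by auto
    then have "(r ^^ (Suc i + (m - j))) (f 0) (f m)"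
      using pow[of j m] that unfolding relpowp_add by blast
    then have "m \<le> Suc i + (m - j)" using least f0 fm by blast
    then show "j = Suc i" using that by simp
  next
    assume "j = Suc i"
    then show "{f i, f j} \<in> E" using step[of i] that by (simp add: r_def)
  qed
  \<comment> \<open>Cyclic order: \<open>f 0\<close> to \<open>f m\<close>, then \<open>x\<close>,
    which is adjacent to \<open>f m\<close>, then \<open>y\<close>, which closes up to
    \<open>f 0\<close>. The length \<open>m + 3\<close> is at least 4 because \<open>A\<close> and
    \<open>B\<close> are disjoint.\<close>
  define g where "g i = (if i \<le> m then f i else if i = Suc m then x else y)" for i
  have "inj_on g {..<m + 3}"
  proof (rule linorder_inj_onI')
    fix i j assume "i \<in> {..<m + 3}" "j \<in> {..<m + 3}" "i < j"
    then show "g i \<noteq> g j"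
      using neq fne \<open>x \<noteq> y\<close> by (auto simp: g_def)
  qed
  moreover have "f i \<in> V" if "i \<le> m" for i
  proof (cases "i = m")
    case True
    then show ?thesis using fx[OF that] inV by blast
  next
    case False
    then show ?thesis using step[of i] that inV by (auto simp: r_def)
  qed
  then have "g ` {..<m + 3} \<subseteq> V"
    using inV[OF xy] by (auto simp: g_def)
  moreover have "{g i, g j} \<in> E \<longleftrightarrow> j = Suc i \<or> i = 0 \<and> j = m + 3 - 1"
    if "i < j" "j < m + 3" for i j
  proof -
    have "j \<le> m \<or> j = Suc m \<or> j = m + 2 \<and> (i \<le> m \<or> i = Suc m)"
      using that by auto
    then show ?thesis
      by (elim disjE conjE) (use that fe fx fy xy in \<open>auto simp: g_def\<close>)
  qed
  moreover have "m + 3 \<ge> 4" using \<open>m \<noteq> 0\<close> by simp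
  ultimately show False
    using ch unfolding chordal_iff[OF G] not_ex
    by (elim allE[of _ "m + 3"] allE[of _ g]) simp
qed

section \<open>Each obstruction yields a weighted asteroidal triple\<close>

text \<open>The three leaves form the triple. The path between two leaves through the centre avoids
  the third leaf although the centre is adjacent to it, since each of its edges has a leaf end that
  is not.\<close>

lemma claw_imp_weighted_asteroidal_triple:
  assumes G: "finite_simple_graph V E" and "\<not> claw_free V E"
  shows "\<exists>T. weighted_asteroidal_triple V (adj_matrix E) T"
proof -
  obtain c a b d where E: "{c, a} \<in> E" "{c, b} \<in> E" "{c, d} \<in> E"
    and ne: "a \<noteq> b" "a \<noteq> d" "b \<noteq> d"
    and nE: "{a, b} \<notin> E" "{a, d} \<notin> E" "{b, d} \<notin> E"
    using assms(2) unfolding claw_free_iff[OF G] not_not by (elim exE conjE) (rule that)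
  have loop: "{v} \<notin> E" for v
    using G by (auto simp: finite_simple_graph_def)
  have inV: "u \<in> V \<and> v \<in> V" if "{u, v} \<in> E" for u v
    using G that by (fastforce simp: finite_simple_graph_def doubleton_eq_iff)
  have cne: "c \<noteq> a" "c \<noteq> b" "c \<noteq> d"
    using E loop by auto
  have "(avoid_step E w)\<^sup>*\<^sup>* u v"
    if "{c, u} \<in> E" "{c, v} \<in> E" "{u, w} \<notin> E" "{v, w} \<notin> E" "u \<noteq> w" "v \<noteq> w" "c \<noteq> w" for u v w
  proof -
    have "avoid_step E w u c" "avoid_step E w c v"
      using that by (auto simp: avoid_step_def insert_commute)
    then show ?thesis by auto
  qed
  then have "(avoid_step E d)\<^sup>*\<^sup>* a b" "(avoid_step E a)\<^sup>*\<^sup>* b d" "(avoid_step E b)\<^sup>*\<^sup>* d a"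
    using E nE ne cne by (simp_all add: insert_commute)
  then show ?thesis
    unfolding weighted_asteroidal_triple_adj_matrix_iff[OF G] using ne inV E by blast
qed

text \<open>Three consecutive vertices form the triple. Each of the two edges among them avoids the
  remaining vertex, and the long arc from \<open>g 2\<close> to \<open>g 0\<close> avoids
  \<open>g 1\<close>: only its two ends are adjacent to \<open>g 1\<close>, and they are not joined
  by an edge.\<close>

lemma induced_cycle_imp_weighted_asteroidal_triple:
  assumes G: "finite_simple_graph V E" and "\<not> chordal V E"
  shows "\<exists>T. weighted_asteroidal_triple V (adj_matrix E) T"
proof -
  obtain n g where n: "n \<ge> 4" and inj: "inj_on g {..<n}" and sub: "g ` {..<n} \<subseteq> V"
    and e: "\<forall>j<n. \<forall>i<j. {g i, g j} \<in> E \<longleftrightarrow> j = Suc i \<or> i = 0 \<and> j = n - 1"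
    using assms(2) unfolding chordal_iff[OF G] not_not by (elim exE conjE) (rule that)
  have ne: "g i \<noteq> g j" if "i < n" "j < n" "i \<noteq> j" for i j
    using inj that by (auto simp: inj_on_def)
  have e': "{g j, g i} \<in> E \<longleftrightarrow> j = Suc i \<or> i = 0 \<and> j = n - 1" if "i < j" "j < n" for i j
    using e[rule_format, OF that(2,1)] by (simp add: insert_commute)
  have "avoid_step E (g 2) (g 0) (g 1)"
    using n by (simp add: avoid_step_def ne e e')
  moreover have "avoid_step E (g 0) (g 1) (g 2)"
    using n by (simp add: avoid_step_def ne e e')
  moreover have "(avoid_step E (g 1))\<^sup>*\<^sup>* (g 2) (g k)" if "2 \<le> k" "k < n" for k
    using that
  proof (induction k rule: dec_induct)
    case (step k)
    then have "avoid_step E (g 1) (g k) (g (Suc k))"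
      using n by (simp add: avoid_step_def ne e e')
    then show ?case using step by auto
  qed simp
  then have "(avoid_step E (g 1))\<^sup>*\<^sup>* (g 2) (g (n - 1))"
    using n by simp
  moreover have "avoid_step E (g 1) (g (n - 1)) (g 0)"
    using n by (simp add: avoid_step_def ne e e')
  moreover have "g 0 \<noteq> g 1" "g 1 \<noteq> g 2" "g 0 \<noteq> g 2" "{g 0, g 1, g 2} \<subseteq> V"
    using n ne sub by auto
  ultimately show ?thesis
    unfolding weighted_asteroidal_triple_adj_matrix_iff[OF G]
    by (meson r_into_rtranclp rtranclp.rtrancl_into_rtrancl)
qed

lemma asteroidal_triple_imp_weighted:
  assumes G: "finite_simple_graph V E" and T: "asteroidal_triple V E T"
  shows "weighted_asteroidal_triple V (adj_matrix E) T"
proof -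
  obtain x y z where xyz: "T = {x, y, z}" "x \<noteq> y" "y \<noteq> z" "x \<noteq> z"
    using T unfolding asteroidal_triple_def by (auto simp: card_3_iff)
  have conn: "(avoid_step E w)\<^sup>*\<^sup>* u v" if uvw: "T = {u, v, w}" "u \<noteq> w" for u v w
  proof -
    obtain p where p: "graph_path V E u v p" and miss: "misses E p w"
      using T uvw unfolding asteroidal_triple_def by blast
    have nE: "{s, w} \<notin> E" if "s \<in> set p" for s
      using miss that by (simp add: misses_def insert_commute)
    have step: "{p ! i, p ! Suc i} \<in> E" if "Suc i < length p" for i
      using p that by (simp add: graph_path_def)
    \<comment> \<open>The start differs from \<open>w\<close>, and a later occurrence of
      \<open>w\<close> would have a predecessor on the path adjacent to \<open>w\<close>.\<close>
    have pw: "p ! i \<noteq> w" if "i < length p" for i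
    proof (cases i)
      case 0
      then show ?thesis
        using p uvw by (auto simp: graph_path_def hd_conv_nth)
    next
      case (Suc j)
      then show ?thesis
        using step[of j] nE[of "p ! j"] that by auto
    qed
    have "avoid_step E w (p ! i) (p ! Suc i)" if "Suc i < length p" for i
      using step[OF that] nE pw that by (simp add: avoid_step_def)
    then show ?thesis
      using path_imp_rtranclp[of p "avoid_step E w"] p by (auto simp: graph_path_def)
  qed
  have "(avoid_step E z)\<^sup>*\<^sup>* x y" "(avoid_step E x)\<^sup>*\<^sup>* y z" "(avoid_step E y)\<^sup>*\<^sup>* z x"
    using xyz by (intro conn; auto)+
  moreover have "T \<subseteq> V"
    using T by (simp add: asteroidal_triple_def)
  ultimately show ?thesis
    unfolding weighted_asteroidal_triple_adj_matrix_iff[OF G] using xyz by blast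
qed

section \<open>Weighted triples by the number of edges they span\<close>

lemma avoid_step_rtranclp_sym: "(avoid_step E z)\<^sup>*\<^sup>* x y \<Longrightarrow> (avoid_step E z)\<^sup>*\<^sup>* y x"
  by (rule sympD[OF symp_rtranclp]) (auto simp: symp_def avoid_step_def insert_commute)

text \<open>As \<open>u\<close> is adjacent to \<open>z\<close>, the first step must leave the
  neighbourhood of \<open>z\<close>, which gives \<open>p\<close>; bypassing the rest of the path up
  to \<open>v\<close> gives \<open>q\<close>.\<close>

lemma detour_between_neighbours:
  assumes G: "finite_simple_graph V E" and claw: "claw_free V E"
    and conn: "(avoid_step E z)\<^sup>*\<^sup>* u v" and "{u, z} \<in> E" "{v, z} \<in> E" "u \<noteq> v"
  obtains p q where "{p, u} \<in> E" "{p, z} \<notin> E" "p \<noteq> z" "{q, v} \<in> E" "{q, z} \<notin> E" "q \<noteq> z"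
    "(miss_step E z)\<^sup>*\<^sup>* p q"
proof -
  obtain p where p: "avoid_step E z u p" "(avoid_step E z)\<^sup>*\<^sup>* p v"
    using conn \<open>u \<noteq> v\<close> by (auto elim: converse_rtranclpE)
  then have *: "{p, u} \<in> E" "{p, z} \<notin> E" "p \<noteq> z"
    using \<open>{u, z} \<in> E\<close> by (auto simp: avoid_step_def insert_commute)
  show thesis
    using bypass_neighbours[OF G claw p(2) *(2,3)] * \<open>{v, z} \<in> E\<close> that by auto
qed

text \<open>Bypassing turns the two connections from \<open>z\<close> into walks to a private
  neighbour \<open>p\<close> of \<open>y\<close> and a private neighbour \<open>q\<close> of
  \<open>x\<close>; joined at \<open>z\<close>, they link \<open>p\<close> to
  \<open>q\<close>.\<close>

lemma no_weighted_triple_one_edge: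
  assumes G: "finite_simple_graph V E" and ch: "chordal V E" and claw: "claw_free V E"
    and E: "{x, y} \<in> E" "{z, x} \<notin> E" "{z, y} \<notin> E" and ne: "z \<noteq> x" "z \<noteq> y"
    and conn: "(avoid_step E x)\<^sup>*\<^sup>* z y" "(avoid_step E y)\<^sup>*\<^sup>* z x"
  shows False
proof -
  let ?r = "\<lambda>u v. {u, v} \<in> E \<and> v \<noteq> x \<and> v \<noteq> y \<and> \<not> ({v, x} \<in> E \<and> {v, y} \<in> E)"
  obtain p where p: "(miss_step E x)\<^sup>*\<^sup>* z p" "{p, x} \<notin> E" "p \<noteq> x" "{p, y} \<in> E"
    using bypass_neighbours[OF G claw conn(1) E(2) ne(1)] E by (auto simp: insert_commute)
  obtain q where q: "(miss_step E y)\<^sup>*\<^sup>* z q" "{q, y} \<notin> E" "q \<noteq> y" "{q, x} \<in> E"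
    using bypass_neighbours[OF G claw conn(2) E(3) ne(2)] E by auto
  \<comment> \<open>A vertex not adjacent to \<open>x\<close> is neither \<open>y\<close> nor a
    common neighbour; likewise with \<open>x\<close> and \<open>y\<close> exchanged.\<close>
  have "miss_step E x \<le> ?r" "miss_step E y \<le> ?r"
    using E by (auto simp: miss_step_def insert_commute)
  then have "?r\<^sup>*\<^sup>* p z" "?r\<^sup>*\<^sup>* z q"
    using rtranclp_mono miss_step_rtranclp_sym[OF p(1)] q(1) by blast+
  then have "?r\<^sup>*\<^sup>* p q" by (rule rtranclp_trans)
  then show False
    using chordal_private_neighbours_disconnected[OF G ch E(1) p(4,2,3) q(4,2,3)] by simp
qed

text \<open>The edge to use is \<open>{y, z}\<close>: the vertex \<open>x\<close> is itself a
  private neighbour of \<open>y\<close>, and the detour around \<open>y\<close> leads to it from a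
  private neighbour of \<open>z\<close>.\<close>

lemma no_weighted_triple_two_edges:
  assumes G: "finite_simple_graph V E" and ch: "chordal V E" and claw: "claw_free V E"
    and E: "{x, y} \<in> E" "{y, z} \<in> E" "{x, z} \<notin> E" and ne: "x \<noteq> y" "x \<noteq> z"
    and conn: "(avoid_step E y)\<^sup>*\<^sup>* z x"
  shows False
proof -
  let ?r = "\<lambda>u v. {u, v} \<in> E \<and> v \<noteq> y \<and> v \<noteq> z \<and> \<not> ({v, y} \<in> E \<and> {v, z} \<in> E)"
  have zy: "{z, y} \<in> E" using E by (simp add: insert_commute)
  obtain p q where p: "{p, z} \<in> E" "{p, y} \<notin> E" "p \<noteq> y"
    and q: "{q, x} \<in> E" and pq: "(miss_step E y)\<^sup>*\<^sup>* p q"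
    using detour_between_neighbours[OF G claw conn zy E(1) ne(2)[symmetric]] by metis
  have "miss_step E y \<le> ?r"
    using zy by (auto simp: miss_step_def)
  then have "?r\<^sup>*\<^sup>* p q"
    using rtranclp_mono pq by blast
  moreover have "?r q x" using q E ne by simp
  ultimately have "?r\<^sup>*\<^sup>* p x" by (rule rtranclp.rtrancl_into_rtrancl)
  then show False
    using chordal_private_neighbours_disconnected[OF G ch E(2) p E(1,3) ne(2)] by simp
qed

text \<open>Without such a \<open>c\<close>, the detour around \<open>z\<close> meets no common
  neighbour of \<open>x\<close> and \<open>y\<close>, and its ends are private neighbours of
  \<open>x\<close> and \<open>y\<close>.\<close>

lemma common_neighbour_in_triangle:
  assumes G: "finite_simple_graph V E" and ch: "chordal V E" and claw: "claw_free V E"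
    and E: "{x, y} \<in> E" "{x, z} \<in> E" "{y, z} \<in> E" and ne: "x \<noteq> y"
    and conn: "(avoid_step E z)\<^sup>*\<^sup>* x y"
  shows "\<exists>c. {c, x} \<in> E \<and> {c, y} \<in> E \<and> {c, z} \<notin> E \<and> c \<noteq> z"
proof (rule ccontr)
  assume "\<not> ?thesis"
  then have none: "\<not> ({c, y} \<in> E \<and> {c, x} \<in> E)" if "{c, z} \<notin> E" "c \<noteq> z" for c
    using that by blast
  let ?r = "\<lambda>u v. {u, v} \<in> E \<and> v \<noteq> y \<and> v \<noteq> x \<and> \<not> ({v, y} \<in> E \<and> {v, x} \<in> E)"
  obtain p q where p: "{p, x} \<in> E" "{p, z} \<notin> E" "p \<noteq> z"
    and q: "{q, y} \<in> E" "{q, z} \<notin> E" "q \<noteq> z" and pq: "(miss_step E z)\<^sup>*\<^sup>* p q"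
    using detour_between_neighbours[OF G claw conn E(2,3) ne] by metis
  have "miss_step E z \<le> ?r"
    using E none by (auto simp: miss_step_def)
  then have "?r\<^sup>*\<^sup>* p q"
    using rtranclp_mono pq by blast
  moreover have "{p, y} \<notin> E" "p \<noteq> y" "{q, x} \<notin> E" "q \<noteq> x" "{y, x} \<in> E"
    using none p q E by (auto simp: insert_commute)
  ultimately show False
    using chordal_private_neighbours_disconnected[OF G ch, of y x p q] p q by simp
qed

text \<open>For the edge \<open>{b, a}\<close>, the private neighbours \<open>d\<close> of
  \<open>a\<close> and \<open>c\<close> of \<open>b\<close> are joined by an edge.\<close>

lemma chordal_no_induced_4_cycle:
  assumes G: "finite_simple_graph V E" and ch: "chordal V E"
    and E: "{a, b} \<in> E" "{b, c} \<in> E" "{c, d} \<in> E" "{d, a} \<in> E"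
    and nE: "{a, c} \<notin> E" "{b, d} \<notin> E" and ne: "a \<noteq> c" "b \<noteq> d"
  shows False
proof -
  have "{b, a} \<in> E" using E by (simp add: insert_commute)
  moreover have "{d, b} \<notin> E" "{c, a} \<notin> E" using nE by (simp_all add: insert_commute)
  moreover have "(\<lambda>u v. {u, v} \<in> E \<and> v \<noteq> b \<and> v \<noteq> a \<and> \<not> ({v, b} \<in> E \<and> {v, a} \<in> E))\<^sup>*\<^sup>* d c"
    using E nE ne by (intro r_into_rtranclp) (auto simp: insert_commute)
  moreover have "{c, b} \<in> E" using E by (simp add: insert_commute)
  ultimately show False
    using chordal_private_neighbours_disconnected[OF G ch, of b a d c] E ne by simp
qed

lemma triangle_imp_asteroidal_triple:
  assumes G: "finite_simple_graph V E" and ch: "chordal V E" and claw: "claw_free V E"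
    and E: "{x, y} \<in> E" "{y, z} \<in> E" "{z, x} \<in> E" and ne: "x \<noteq> y" "y \<noteq> z" "z \<noteq> x"
    and conn: "(avoid_step E z)\<^sup>*\<^sup>* x y" "(avoid_step E x)\<^sup>*\<^sup>* y z" "(avoid_step E y)\<^sup>*\<^sup>* z x"
  shows "\<exists>T. asteroidal_triple V E T"
proof -
  have E': "{y, x} \<in> E" "{z, y} \<in> E" "{x, z} \<in> E"
    using E by (simp_all add: insert_commute)
  obtain c where c: "{c, x} \<in> E" "{c, y} \<in> E" "{c, z} \<notin> E" "c \<noteq> z"
    using common_neighbour_in_triangle[OF G ch claw E(1) E'(3) E(2) ne(1) conn(1)] by blast
  obtain a where a: "{a, y} \<in> E" "{a, z} \<in> E" "{a, x} \<notin> E" "a \<noteq> x"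
    using common_neighbour_in_triangle[OF G ch claw E(2) E'(1) E(3) ne(2) conn(2)] by blast
  obtain b where b: "{b, z} \<in> E" "{b, x} \<in> E" "{b, y} \<notin> E" "b \<noteq> y"
    using common_neighbour_in_triangle[OF G ch claw E(3) E'(2) E(1) ne(3) conn(3)] by blast
  have inV: "u \<in> V" if "{u, v} \<in> E" for u v
    using G that by (fastforce simp: finite_simple_graph_def doubleton_eq_iff)
  \<comment> \<open>An edge between two of the new vertices closes an induced 4-cycle with the two
    triangle vertices to which exactly one of them is adjacent.\<close>
  have ind: "{a, b} \<notin> E" "{b, c} \<notin> E" "{c, a} \<notin> E"
    using chordal_no_induced_4_cycle[OF G ch, of a b x y]
      chordal_no_induced_4_cycle[OF G ch, of b c y z]
      chordal_no_induced_4_cycle[OF G ch, of c a z x] a b c E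
    by (auto simp: insert_commute)
  have "a \<noteq> b" "b \<noteq> c" "a \<noteq> c"
    using a b c by auto
  moreover have via: "(miss_step E w)\<^sup>*\<^sup>* u v"
    if "{u, s} \<in> E" "{v, s} \<in> E" "{w, s} \<notin> E" "{u, w} \<notin> E" "{v, w} \<notin> E"
      "u \<noteq> w" "v \<noteq> w" "s \<noteq> w" for u v w s
  proof -
    have "miss_step E w u s" "miss_step E w s v"
      using that by (auto simp: miss_step_def insert_commute)
    then show ?thesis by auto
  qed
  \<comment> \<open>Two of the new vertices share a triangle vertex as neighbour, and the third is
    not adjacent to it.\<close>
  have "(miss_step E c)\<^sup>*\<^sup>* a b" "(miss_step E a)\<^sup>*\<^sup>* b c" "(miss_step E b)\<^sup>*\<^sup>* c a"
    using via[of a z b c] via[of b x c a] via[of c y a b] a b c ind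
      \<open>a \<noteq> b\<close> \<open>b \<noteq> c\<close> \<open>a \<noteq> c\<close>
    by (simp_all add: insert_commute)
  ultimately show ?thesis
    using asteroidal_tripleI[OF G, of a b c] inV a b c ind by blast
qed

lemma weighted_imp_asteroidal_triple:
  assumes G: "finite_simple_graph V E" and ch: "chordal V E" and claw: "claw_free V E"
    and "weighted_asteroidal_triple V (adj_matrix E) T"
  shows "\<exists>T. asteroidal_triple V E T"
proof -
  obtain x y z where V: "x \<in> V" "y \<in> V" "z \<in> V" and ne: "x \<noteq> y" "y \<noteq> z" "x \<noteq> z"
    and conn: "(avoid_step E z)\<^sup>*\<^sup>* x y" "(avoid_step E x)\<^sup>*\<^sup>* y z" "(avoid_step E y)\<^sup>*\<^sup>* z x"
    using assms(4) unfolding weighted_asteroidal_triple_adj_matrix_iff[OF G] by blast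
  note conn' = conn[THEN avoid_step_rtranclp_sym]
  note one = no_weighted_triple_one_edge[OF G ch claw]
  note two = no_weighted_triple_two_edges[OF G ch claw]
  have comm: "{y, x} = {x, y}" "{z, y} = {y, z}" "{x, z} = {z, x}" by auto
  show ?thesis
  proof (cases "{x, y} \<in> E"; cases "{y, z} \<in> E"; cases "{z, x} \<in> E")
    assume "{x, y} \<in> E" "{y, z} \<in> E" "{z, x} \<in> E"
    then show ?thesis
      using triangle_imp_asteroidal_triple[OF G ch claw] ne conn by metis
  next
    assume nE: "{x, y} \<notin> E" "{y, z} \<notin> E" "{z, x} \<notin> E"
    \<comment> \<open>For an independent triple the end \<open>v\<close> is not adjacent to
      \<open>w\<close>, so the bypassed path ends at \<open>v\<close> itself.\<close>
    have "(miss_step E w)\<^sup>*\<^sup>* u v"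
      if "(avoid_step E w)\<^sup>*\<^sup>* u v" "{u, w} \<notin> E" "u \<noteq> w" "{v, w} \<notin> E" for u v w
      using bypass_neighbours[OF G claw that(1-3)] that(4) by auto
    then have "(miss_step E z)\<^sup>*\<^sup>* x y" "(miss_step E x)\<^sup>*\<^sup>* y z" "(miss_step E y)\<^sup>*\<^sup>* z x"
      using conn nE ne comm by metis+
    then show ?thesis
      using asteroidal_tripleI[OF G V ne nE] by blast
  \<comment> \<open>The six cases with one or two edges are rotations of one another; reversed
    connections supply the required directions.\<close>
  qed (use one[of x y z] one[of y z x] one[of z x y] two[of x y z] two[of y z x] two[of z x y]
      conn conn' ne comm in auto)
qed

theorem theorem4p1:
  fixes V :: "'a set" and E :: "'a set set"
  assumes "finite_simple_graph V E"
  shows "(chordal V E \<and> claw_free V E \<and> (\<nexists>T. asteroidal_triple V E T)) \<longleftrightarrow>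
         (\<nexists>T. weighted_asteroidal_triple V (adj_matrix E) T)"
proof
  assume "chordal V E \<and> claw_free V E \<and> (\<nexists>T. asteroidal_triple V E T)"
  then show "\<nexists>T. weighted_asteroidal_triple V (adj_matrix E) T"
    using weighted_imp_asteroidal_triple[OF assms] by blast
next
  assume "\<nexists>T. weighted_asteroidal_triple V (adj_matrix E) T"
  then show "chordal V E \<and> claw_free V E \<and> (\<nexists>T. asteroidal_triple V E T)"
    using induced_cycle_imp_weighted_asteroidal_triple[OF assms]
      claw_imp_weighted_asteroidal_triple[OF assms] asteroidal_triple_imp_weighted[OF assms]
    by blast
qed

end
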